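(* Let $k\ge 1$ be a natural number, let $I\subset\mathbb{R}$ be a subset of cardinality $|I|>k$, and let $M$ be a set. (i) If $\omega$ is a $k$-frontal embedding into $M^I$, then the map $$\varphi\colon\bigcup_{\sigma\in C_k(I)}\operatorname{cod}\omega_\sigma\ni a\mapsto \varphi_a=\omega\bigl(\omega_{\operatorname{dom}a}^{-1}(a)\bigr)\in\operatorname{cod}\omega$$ is a solution of the functional equations $$\varphi_{\varphi_a|_\beta}=\varphi_a,\qquad \varphi_a|_{\operatorname{dom}a}=a\qquad\text{for all } a\in\operatorname{dom}\varphi,\ \beta\in C_k(I). \quad ( * )$$ (ii) Conversely, if a surjective map $\varphi\colon a\mapsto\varphi_a$ with $\operatorname{dom}\varphi\subset\bigcup_{\alpha\in C_k(I)}M^\alpha$ and $\operatorname{cod}\varphi\subset M^I$ is a solution of the functional equations $( * )$, then there exists a $k$-frontal embedding $\omega$ into $M^I$ such that $\operatorname{dom}\varphi=\bigcup_{\sigma\in C_k(I)}\operatorname{cod}\omega_\sigma$, $\operatorname{cod}\varphi=\operatorname{cod}\omega$, and $\varphi_a=\omega\bigl(\omega_{\operatorname{dom}a}^{-1}(a)\bigr)$ for all $a\in\operatorname{dom}\varphi$.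
   Context: Notation. For a set $S$, $C_k(S)$ is the set of all subsets of $S$ with exactly $k$ elements, and $M^S$ is the set of all maps from $S$ to $M$. $\operatorname{dom}$ and $\operatorname{cod}$ denote domain and codomain; for a surjective map the codomain is its image. The equation $\varphi_{\varphi_a|_\beta}=\varphi_a$ includes the assertion that $\varphi_a|_\beta\in\operatorname{dom}\varphi$. $k$-frontal embedding into $M^I$: a surjective map $\omega$ from some set $\operatorname{dom}\omega$ onto a set $\operatorname{cod}\omega\subset M^I$ such that for every $\beta\in C_k(I)$ the surjection $$\omega_\beta\colon\operatorname{dom}\omega\ni w\mapsto\omega(w)|_\beta\in\operatorname{cod}\omega_\beta\subset M^\beta$$ (where $\operatorname{cod}\omega_\beta$ is the image of this map) is a bijection. *)

theory Defs
  imports Complex_Main "HOL-Library.Ramsey"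
begin

text \<open>
  Elements of \<open>M\<^sup>S\<close> are partial maps (type \<open>'i \<rightharpoonup> 'm\<close>) whose domain is exactly \<open>S\<close>, so that
  the domain of an element can be recovered by \<^const>\<open>dom\<close>, and restriction to a subset is
  \<^const>\<open>restrict_map\<close>.
  The set \<open>C\<^sub>k(S)\<close> of all \<open>k\<close>-element subsets of \<open>S\<close> is \<open>nsets S k\<close>.
\<close>

definition maps_on :: "'i set \<Rightarrow> 'm set \<Rightarrow> ('i \<rightharpoonup> 'm) set" where
  "maps_on S M = {f. dom f = S \<and> ran f \<subseteq> M}"

text \<open>
  A surjective map with a prescribed domain is given by a carrier set together with a HOL function,
  of which only the values on the carrier matter; its codomain is the image of the carrier.
\<close>

definition front :: "('w \<Rightarrow> ('i \<rightharpoonup> 'm)) \<Rightarrow> 'i set \<Rightarrow> 'w \<Rightarrow> ('i \<rightharpoonup> 'm)" where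
  "front \<omega> \<beta> w = \<omega> w |` \<beta>"

definition frontal_embedding ::
    "nat \<Rightarrow> 'i set \<Rightarrow> 'm set \<Rightarrow> 'w set \<Rightarrow> ('w \<Rightarrow> ('i \<rightharpoonup> 'm)) \<Rightarrow> bool" where
  "frontal_embedding k I M W \<omega> \<longleftrightarrow>
     \<omega> ` W \<subseteq> maps_on I M \<and>
     (\<forall>\<beta>\<in>nsets I k. bij_betw (front \<omega> \<beta>) W (front \<omega> \<beta> ` W))"

definition fronts :: "nat \<Rightarrow> 'i set \<Rightarrow> 'w set \<Rightarrow> ('w \<Rightarrow> ('i \<rightharpoonup> 'm)) \<Rightarrow> ('i \<rightharpoonup> 'm) set" where
  "fronts k I W \<omega> = (\<Union>\<sigma>\<in>nsets I k. front \<omega> \<sigma> ` W)"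

definition reconstruct :: "'w set \<Rightarrow> ('w \<Rightarrow> ('i \<rightharpoonup> 'm)) \<Rightarrow> ('i \<rightharpoonup> 'm) \<Rightarrow> ('i \<rightharpoonup> 'm)" where
  "reconstruct W \<omega> a = \<omega> (the_inv_into W (front \<omega> (dom a)) a)"

definition functional_equations ::
    "nat \<Rightarrow> 'i set \<Rightarrow> ('i \<rightharpoonup> 'm) set \<Rightarrow> (('i \<rightharpoonup> 'm) \<Rightarrow> ('i \<rightharpoonup> 'm)) \<Rightarrow> bool" where
  "functional_equations k I D \<phi> \<longleftrightarrow>
     (\<forall>a\<in>D. \<forall>\<beta>\<in>nsets I k.
        \<phi> a |` \<beta> \<in> D \<and> \<phi> (\<phi> a |` \<beta>) = \<phi> a \<and> \<phi> a |` dom a = a)"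

end

theory Submission imports Defs begin

text \<open>A front of \<open>w\<close> carries its index set as its domain and, by injectivity of
  the restriction to that set, determines \<open>w\<close>. So \<open>reconstruct\<close> sends all
  fronts of \<open>w\<close> to the same map \<open>\<omega> w\<close>
  (\<open>reconstruct_front\<close>), and the functional equations merely record this. Conversely,
  let \<omega> be the inclusion of the codomain of \<phi>. The first equation makes \<phi> a left
  inverse of each restriction to \<beta>, so the inclusion is a frontal embedding. The second
  exhibits each \<open>a\<close> in \<open>D\<close> as a front of \<open>\<phi> a\<close>, so the
  fronts are exactly \<open>D\<close>, and \<open>reconstruct_front\<close> identifies
  \<open>reconstruct\<close> with \<phi>.\<close>

text \<open>Since \<open>\<omega> w\<close> is defined on all of \<open>I\<close>, restricting it to
  \<sigma> loses no point of \<sigma>. This lets \<open>reconstruct\<close> read off which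
  restriction to invert.\<close>

lemma dom_front:
  assumes "frontal_embedding k I M W \<omega>" and "w \<in> W" and "\<sigma> \<in> nsets I k"
  shows "dom (front \<omega> \<sigma> w) = \<sigma>"
  using assms unfolding frontal_embedding_def maps_on_def nsets_def front_def by fastforce

lemma reconstruct_front:
  assumes "frontal_embedding k I M W \<omega>" and "w \<in> W" and "\<sigma> \<in> nsets I k"
  shows "reconstruct W \<omega> (front \<omega> \<sigma> w) = \<omega> w"
proof -
  have "inj_on (front \<omega> \<sigma>) W"
    using assms by (auto simp: frontal_embedding_def bij_betw_def)
  then show ?thesis
    using assms by (simp add: reconstruct_def dom_front the_inv_into_f_f)
qed

lemma reconstruct_fronts_subset:
  assumes "frontal_embedding k I M W \<omega>"
  shows "reconstruct W \<omega> ` fronts k I W \<omega> \<subseteq> \<omega> ` W"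
  using assms by (auto simp: fronts_def reconstruct_front)

lemma functional_equations_reconstruct:
  assumes "frontal_embedding k I M W \<omega>"
  shows "functional_equations k I (fronts k I W \<omega>) (reconstruct W \<omega>)"
  unfolding functional_equations_def
proof (intro ballI)
  fix a \<beta>
  assume "a \<in> fronts k I W \<omega>" and \<beta>: "\<beta> \<in> nsets I k"
  then obtain \<sigma> w where \<sigma>: "\<sigma> \<in> nsets I k" and w: "w \<in> W" and a: "a = front \<omega> \<sigma> w"
    by (auto simp: fronts_def)
  \<comment> \<open>Both \<open>a\<close> and its companion on \<beta> are fronts of the one point
    \<open>w\<close>, so both are sent to \<open>\<omega> w\<close>.\<close>
  have "reconstruct W \<omega> a = \<omega> w"
    using assms w \<sigma> by (simp add: a reconstruct_front)
  moreover have "front \<omega> \<beta> w \<in> fronts k I W \<omega>"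
    using w \<beta> by (auto simp: fronts_def)
  moreover have "dom a = \<sigma>"
    using assms w \<sigma> by (simp add: a dom_front)
  ultimately show "reconstruct W \<omega> a |` \<beta> \<in> fronts k I W \<omega> \<and>
      reconstruct W \<omega> (reconstruct W \<omega> a |` \<beta>) = reconstruct W \<omega> a \<and>
      reconstruct W \<omega> a |` dom a = a"
    using reconstruct_front[OF assms w \<beta>] by (simp add: a front_def)
qed

text \<open>The first functional equation says that \<phi> itself undoes restriction to \<beta> on
  its own image.\<close>

lemma frontal_embedding_id_image:
  assumes "\<phi> ` D \<subseteq> maps_on I M" and "functional_equations k I D \<phi>"
  shows "frontal_embedding k I M (\<phi> ` D) id"
proof -
  have "inj_on (front id \<beta>) (\<phi> ` D)" if "\<beta> \<in> nsets I k" for \<beta>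
  proof (rule inj_on_inverseI)
    fix x
    assume "x \<in> \<phi> ` D"
    then show "\<phi> (front id \<beta> x) = x"
      using assms(2) that by (auto simp: functional_equations_def front_def)
  qed
  then show ?thesis
    using assms(1) by (simp add: frontal_embedding_def inj_on_imp_bij_betw)
qed

text \<open>One inclusion is the membership clause of the functional equations; the other holds
  because \<open>a\<close> is the restriction of \<open>\<phi> a\<close> to
  \<open>dom a\<close>.\<close>

lemma fronts_id_image:
  assumes "D \<subseteq> (\<Union>\<alpha>\<in>nsets I k. maps_on \<alpha> M)" and "functional_equations k I D \<phi>"
  shows "fronts k I (\<phi> ` D) id = D"
proof
  show "fronts k I (\<phi> ` D) id \<subseteq> D"
    using assms(2) by (auto simp: fronts_def front_def functional_equations_def)
  show "D \<subseteq> fronts k I (\<phi> ` D) id"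
  proof
    fix a
    assume a: "a \<in> D"
    then have "dom a \<in> nsets I k"
      using assms(1) by (auto simp: maps_on_def)
    \<comment> \<open>The second equation stands under the quantifier over \<beta>;
      \<open>dom a\<close> serves as the required instance.\<close>
    moreover from this have "a = front id (dom a) (\<phi> a)"
      using assms(2) a unfolding functional_equations_def front_def by simp
    ultimately show "a \<in> fronts k I (\<phi> ` D) id"
      using a unfolding fronts_def by blast
  qed
qed

lemma reconstruct_id_image:
  assumes "D \<subseteq> (\<Union>\<alpha>\<in>nsets I k. maps_on \<alpha> M)" and "\<phi> ` D \<subseteq> maps_on I M"
    and "functional_equations k I D \<phi>" and "a \<in> D"
  shows "reconstruct (\<phi> ` D) id a = \<phi> a"
proof -
  have dom_a: "dom a \<in> nsets I k"
    using assms(1,4) by (auto simp: maps_on_def)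
  then have "front id (dom a) (\<phi> a) = a"
    using assms(3,4) by (simp add: functional_equations_def front_def)
  \<comment> \<open>As \<open>a\<close> is the front on \<open>dom a\<close> of the point
    \<open>\<phi> a\<close>, reconstruction from \<open>a\<close> returns that point.\<close>
  then show ?thesis
    using reconstruct_front[OF frontal_embedding_id_image[OF assms(2,3)] imageI[OF assms(4)] dom_a]
    by simp
qed

theorem theorem2:
  fixes k :: nat and I :: "real set" and M :: "'m set"
  assumes "k \<ge> 1" and "infinite I \<or> card I > k"
  shows
    "(\<forall>(W :: 'w set) (\<omega> :: 'w \<Rightarrow> (real \<rightharpoonup> 'm)).
        frontal_embedding k I M W \<omega> \<longrightarrow>
        reconstruct W \<omega> ` fronts k I W \<omega> \<subseteq> \<omega> ` W \<and>
        functional_equations k I (fronts k I W \<omega>) (reconstruct W \<omega>))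
     \<and>
     (\<forall>(D :: (real \<rightharpoonup> 'm) set) (\<phi> :: (real \<rightharpoonup> 'm) \<Rightarrow> (real \<rightharpoonup> 'm)).
        D \<subseteq> (\<Union>\<alpha>\<in>nsets I k. maps_on \<alpha> M) \<and>
        \<phi> ` D \<subseteq> maps_on I M \<and>
        functional_equations k I D \<phi> \<longrightarrow>
        (\<exists>(W :: (real \<rightharpoonup> 'm) set) (\<omega> :: (real \<rightharpoonup> 'm) \<Rightarrow> (real \<rightharpoonup> 'm)).
           frontal_embedding k I M W \<omega> \<and>
           D = fronts k I W \<omega> \<and>
           \<phi> ` D = \<omega> ` W \<and>
           (\<forall>a\<in>D. \<phi> a = reconstruct W \<omega> a)))"
proof (intro conjI allI impI)
  fix W :: "'w set" and \<omega> :: "'w \<Rightarrow> (real \<rightharpoonup> 'm)"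
  assume "frontal_embedding k I M W \<omega>"
  then show "reconstruct W \<omega> ` fronts k I W \<omega> \<subseteq> \<omega> ` W"
    and "functional_equations k I (fronts k I W \<omega>) (reconstruct W \<omega>)"
    by (rule reconstruct_fronts_subset functional_equations_reconstruct)+
next
  fix D :: "(real \<rightharpoonup> 'm) set" and \<phi> :: "(real \<rightharpoonup> 'm) \<Rightarrow> (real \<rightharpoonup> 'm)"
  assume "D \<subseteq> (\<Union>\<alpha>\<in>nsets I k. maps_on \<alpha> M) \<and> \<phi> ` D \<subseteq> maps_on I M \<and>
    functional_equations k I D \<phi>"
  then have D: "D \<subseteq> (\<Union>\<alpha>\<in>nsets I k. maps_on \<alpha> M)" and \<phi>: "\<phi> ` D \<subseteq> maps_on I M"
    and fe: "functional_equations k I D \<phi>"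
    by auto
  show "\<exists>(W :: (real \<rightharpoonup> 'm) set) \<omega>. frontal_embedding k I M W \<omega> \<and> D = fronts k I W \<omega> \<and>
      \<phi> ` D = \<omega> ` W \<and> (\<forall>a\<in>D. \<phi> a = reconstruct W \<omega> a)"
    using frontal_embedding_id_image[OF \<phi> fe] fronts_id_image[OF D fe]
      reconstruct_id_image[OF D \<phi> fe]
    \<comment> \<open>The witness is the codomain of \<phi>, included in the maps on
      \<open>I\<close>.\<close>
    by (intro exI[of _ "\<phi> ` D"] exI[of _ id]) simp
qed

end
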